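(* Let $R$ be a Mori domain with quotient field $K$, $R\neq K$. The following conditions are equivalent: (1) $R$ is $w$-divisorial; (2) $R$ is strongly $w$-divisorial; (3) each $t$-flat overring of $R$ is $w$-divisorial; (4) each generalized ring of fractions of $R$ is $w$-divisorial; (5) $R_M$ is a divisorial domain for each $M\in t\text{-Max}(R)$.
   Context: For a domain $D$ with quotient field $K\neq D$ and fractional ideals $I,J$, put $(J:I)=\{x\in K: xI\subseteq J\}$. For a nonzero fractional ideal $I$ of $D$: $I_v=(D:(D:I))$; $I_t=\bigcup J_v$, the union over nonzero finitely generated fractional ideals $J\subseteq I$. $I$ is divisorial if $I=I_v$, a $t$-ideal if $I=I_t$. A $t$-prime is a nonzero prime ideal that is a $t$-ideal; a $t$-maximal ideal is an ideal maximal among the proper integral $t$-ideals (it is prime). $t\text{-Max}(D)$ and $t\text{-Spec}(D)$ are the sets of $t$-maximal and $t$-prime ideals. $I_w=\bigcap_{M\in t\text{-Max}(D)}ID_M$, and $I$ is a $w$-ideal if $I=I_w$. $D$ is Mori if it satisfies the ascending chain condition on proper divisorial ideals. $D$ is divisorial if every nonzero ideal is divisorial; $w$-divisorial if every $w$-ideal is divisorial; strongly $w$-divisorial if it is $w$-divisorial and $D_P$ is divisorial for each $P\in t\text{-Spec}(D)$. A field is regarded as (trivially) $w$-divisorial. An overring of $R$ is a ring $T$ with $R\subseteq T\subseteq K$; it is $t$-flat over $R$ if $T_M=R_{M\cap R}$ for each $t$-maximal ideal $M$ of $T$ ($K$ is considered $t$-flat over $R$). A multiplicative system of ideals of $R$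 is a nonempty family $\mathcal F$ of nonzero ideals of $R$ with $IJ\in\mathcal F$ for all $I,J\in\mathcal F$; the overring $R_{\mathcal F}=\bigcup\{(R:J): J\in\mathcal F\}$ is the generalized ring of fractions of $R$ with respect to $\mathcal F$. *)

theory Defs
  imports "HOL-Algebra.Algebraic_Closure_Type" "HOL-Algebra.Ideal_Product"
begin

text \<open>
  The quotient field is a type \<open>'k\<close> of class \<open>field\<close>. Domains, overrings, localizations and
  fractional ideals are all subsets of \<open>'k\<close>.
\<close>

abbreviation ring_on :: "'k::field set \<Rightarrow> 'k ring"
  where "ring_on D \<equiv> ring_of_type_algebra\<lparr>carrier := D\<rparr>"

abbreviation ambient :: "'k::field ring"
  where "ambient \<equiv> ring_of_type_algebra"

definition domain_with_qf :: "'k::field set \<Rightarrow> bool"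
  where "domain_with_qf D \<longleftrightarrow>
    subring D ambient \<and> (\<forall>x. \<exists>a\<in>D. \<exists>b\<in>D. b \<noteq> 0 \<and> x = a / b)"

definition overring :: "'k::field set \<Rightarrow> 'k set \<Rightarrow> bool"
  where "overring R T \<longleftrightarrow> subring T ambient \<and> R \<subseteq> T"

text \<open>The localization of \<open>D\<close> at the complement of the prime ideal \<open>P\<close>.\<close>

definition loc :: "'k::field set \<Rightarrow> 'k set \<Rightarrow> 'k set"
  where "loc D P = {a / s |a s. a \<in> D \<and> s \<in> D \<and> s \<notin> P}"

definition subK_module :: "'k::field set \<Rightarrow> 'k set \<Rightarrow> bool"
  where "subK_module D I \<longleftrightarrow> additive_subgroup I ambient \<and> (\<forall>d\<in>D. \<forall>x\<in>I. d * x \<in> I)"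

definition fractional_ideal :: "'k::field set \<Rightarrow> 'k set \<Rightarrow> bool"
  where "fractional_ideal D I \<longleftrightarrow>
    subK_module D I \<and> (\<exists>d\<in>D. d \<noteq> 0 \<and> (\<forall>x\<in>I. d * x \<in> D))"

definition finitely_generated :: "'k::field set \<Rightarrow> 'k set \<Rightarrow> bool"
  where "finitely_generated D I \<longleftrightarrow> (\<exists>S. finite S \<and> I = subK_module D hull S)"

text \<open>\<open>colon J I\<close> is $(J:I)$, computed in the quotient field.\<close>

definition colon :: "'k::field set \<Rightarrow> 'k set \<Rightarrow> 'k set"
  where "colon J I = {x. \<forall>y\<in>I. x * y \<in> J}"

definition v_closure :: "'k::field set \<Rightarrow> 'k set \<Rightarrow> 'k set"
  where "v_closure D I = colon D (colon D I)"

definition t_closure :: "'k::field set \<Rightarrow> 'k set \<Rightarrow> 'k set"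
  where "t_closure D I =
    \<Union>{v_closure D J |J. fractional_ideal D J \<and> J \<noteq> {0} \<and> finitely_generated D J \<and> J \<subseteq> I}"

definition divisorial_ideal :: "'k::field set \<Rightarrow> 'k set \<Rightarrow> bool"
  where "divisorial_ideal D I \<longleftrightarrow> fractional_ideal D I \<and> I \<noteq> {0} \<and> I = v_closure D I"

definition t_ideal :: "'k::field set \<Rightarrow> 'k set \<Rightarrow> bool"
  where "t_ideal D I \<longleftrightarrow> fractional_ideal D I \<and> I \<noteq> {0} \<and> I = t_closure D I"

definition t_Spec :: "'k::field set \<Rightarrow> 'k set set"
  where "t_Spec D = {P. primeideal P (ring_on D) \<and> t_ideal D P}"

definition t_Max :: "'k::field set \<Rightarrow> 'k set set"
  where "t_Max D = {M. t_ideal D M \<and> M \<subset> D \<and> (\<forall>J. t_ideal D J \<and> J \<subset> D \<and> M \<subseteq> J \<longrightarrow> J = M)}"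

text \<open>The products $I D_M$ are formed in the quotient field. If \<open>D\<close> is the whole field, then
  \<open>t_Max D\<close> is empty and the intersection is \<open>UNIV\<close>, the only nonzero fractional ideal.\<close>

definition w_closure :: "'k::field set \<Rightarrow> 'k set \<Rightarrow> 'k set"
  where "w_closure D I = (\<Inter>M\<in>t_Max D. ideal_prod ambient I (loc D M))"

definition w_ideal :: "'k::field set \<Rightarrow> 'k set \<Rightarrow> bool"
  where "w_ideal D I \<longleftrightarrow> fractional_ideal D I \<and> I \<noteq> {0} \<and> I = w_closure D I"

text \<open>Strict inclusion in \<open>D\<close> expresses that the divisorial ideals are integral and proper.\<close>

definition Mori :: "'k::field set \<Rightarrow> bool"
  where "Mori D \<longleftrightarrow>
    (\<forall>I :: nat \<Rightarrow> 'k set. (\<forall>n. divisorial_ideal D (I n) \<and> I n \<subset> D \<and> I n \<subseteq> I (Suc n))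
      \<longrightarrow> (\<exists>N. \<forall>n\<ge>N. I n = I N))"

definition divisorial_domain :: "'k::field set \<Rightarrow> bool"
  where "divisorial_domain D \<longleftrightarrow>
    (\<forall>I. ideal I (ring_on D) \<and> I \<noteq> {0} \<longrightarrow> divisorial_ideal D I)"

definition w_divisorial :: "'k::field set \<Rightarrow> bool"
  where "w_divisorial D \<longleftrightarrow> D = UNIV \<or> (\<forall>I. w_ideal D I \<longrightarrow> divisorial_ideal D I)"

definition strongly_w_divisorial :: "'k::field set \<Rightarrow> bool"
  where "strongly_w_divisorial D \<longleftrightarrow>
    w_divisorial D \<and> (\<forall>P\<in>t_Spec D. divisorial_domain (loc D P))"

definition t_flat :: "'k::field set \<Rightarrow> 'k set \<Rightarrow> bool"
  where "t_flat R T \<longleftrightarrow> T = UNIV \<or> (\<forall>M\<in>t_Max T. loc T M = loc R (M \<inter> R))"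

definition multiplicative_system :: "'k::field set \<Rightarrow> 'k set set \<Rightarrow> bool"
  where "multiplicative_system R F \<longleftrightarrow>
    F \<noteq> {} \<and> (\<forall>I\<in>F. ideal I (ring_on R) \<and> I \<noteq> {0}) \<and>
    (\<forall>I\<in>F. \<forall>J\<in>F. ideal_prod (ring_on R) I J \<in> F)"

definition generalized_fractions :: "'k::field set \<Rightarrow> 'k set set \<Rightarrow> 'k set"
  where "generalized_fractions R F = (\<Union>J\<in>F. colon R J)"

end

theory Submission
  imports Defs
begin

text \<open>
  In a Mori domain every ideal \<open>I\<close> contains a finite set \<open>F\<close> with $(R:F) = (R:I)$. Hence
  $(R:I)R_P = (R_P:IR_P)$ for every prime \<open>P\<close>, and $v$-closure commutes with localization.
  An ideal \<open>J\<close> of $R_P$, for a prime \<open>P\<close> inside a $t$-maximal ideal, is the localization of the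
  $w$-ideal $(J \<inter> R)_w$, so it is divisorial if \<open>R\<close> is $w$-divisorial. Conversely, a $w$-ideal is the
  intersection of its localizations at the $t$-maximal ideals, so it is divisorial if all of these
  are. A $t$-flat overring \<open>T\<close> inherits the finiteness property, and its $t$-maximal ideals contract
  to $t$-primes of \<open>R\<close>, so its localizations are again divisorial. Finally, generalized rings of
  fractions of a Mori domain are $t$-flat.
\<close>

subsection \<open>Subrings and submodules of the quotient field\<close>

lemma ambient_simps [simp]:
  "carrier ambient = UNIV" "x \<oplus>\<^bsub>ambient\<^esub> y = x + y" "x \<otimes>\<^bsub>ambient\<^esub> y = x * y"
  "\<zero>\<^bsub>ambient\<^esub> = 0" "\<one>\<^bsub>ambient\<^esub> = 1"
  by (simp_all add: ring_of_type_algebra_def)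

lemma ambient_a_inv [simp]: "\<ominus>\<^bsub>ambient\<^esub> x = - (x :: 'k::field)"
proof -
  interpret ring "ambient :: 'k ring" by (rule ring_from_type_algebra)
  show ?thesis by (rule minus_equality) auto
qed

text \<open>Unfolding \<open>subgroup_def\<close> for the additive monoid leaves the negative in
  this raw form, with \<open>a_inv\<close> expanded.\<close>

lemma ambient_add_inv [simp]: "inv\<^bsub>\<lparr>carrier = UNIV, monoid.mult = (\<oplus>\<^bsub>ambient\<^esub>), one = 0\<rparr>\<^esub> x = - (x :: 'k::field)"
  using ambient_a_inv[of x] by (simp add: a_inv_def)

lemma subring_ambient_iff:
  "subring D (ambient :: 'k::field ring) \<longleftrightarrow>
    0 \<in> D \<and> 1 \<in> D \<and> (\<forall>x\<in>D. \<forall>y\<in>D. x + y \<in> D) \<and> (\<forall>x\<in>D. - x \<in> D) \<and>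
    (\<forall>x\<in>D. \<forall>y\<in>D. x * y \<in> D)"
  unfolding subring_def subgroup_def submonoid_def by auto

lemma additive_subgroup_ambient_iff:
  "additive_subgroup I (ambient :: 'k::field ring) \<longleftrightarrow>
    0 \<in> I \<and> (\<forall>x\<in>I. \<forall>y\<in>I. x + y \<in> I) \<and> (\<forall>x\<in>I. - x \<in> I)"
  unfolding additive_subgroup_def subgroup_def by auto

text \<open>One denominator for each element replaces the representation as a fraction, because this
  form passes at once to larger subrings of \<open>'k\<close>.\<close>

locale fraction_domain =
  fixes D :: "'k::field set"
  assumes zero_mem: "0 \<in> D" and one_mem: "1 \<in> D"
    and add_mem: "x \<in> D \<Longrightarrow> y \<in> D \<Longrightarrow> x + y \<in> D"
    and uminus_mem: "x \<in> D \<Longrightarrow> - x \<in> D"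
    and mult_mem: "x \<in> D \<Longrightarrow> y \<in> D \<Longrightarrow> x * y \<in> D"
    and denominator: "\<exists>d\<in>D. d \<noteq> 0 \<and> d * x \<in> D"

lemma domain_with_qf_fraction_domain:
  assumes "domain_with_qf D"
  shows "fraction_domain D"
proof -
  have D: "subring D ambient" and q: "\<exists>a\<in>D. \<exists>b\<in>D. b \<noteq> 0 \<and> x = a / b" for x
    using assms by (auto simp: domain_with_qf_def)
  show ?thesis
  proof
    fix x
    obtain a b where "a \<in> D" "b \<in> D" "b \<noteq> 0" "x = a / b" using q by blast
    then show "\<exists>d\<in>D. d \<noteq> 0 \<and> d * x \<in> D" by (intro bexI[of _ b]) auto
  qed (use D in \<open>auto simp: subring_ambient_iff\<close>)
qed

lemma fraction_domain_overring:
  assumes "fraction_domain R" "overring R T"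
  shows "fraction_domain T"
proof -
  interpret R: fraction_domain R by fact
  show ?thesis
  proof
    show "\<exists>d\<in>T. d \<noteq> 0 \<and> d * x \<in> T" for x
      using R.denominator[of x] assms(2) by (auto simp: overring_def)
  qed (use assms(2) in \<open>auto simp: overring_def subring_ambient_iff\<close>)
qed

lemma (in fraction_domain) subring_ambient: "subring D ambient"
  using zero_mem one_mem add_mem uminus_mem mult_mem by (simp add: subring_ambient_iff)

text \<open>Negation is multiplication by \<open>-1\<close>, which lies in \<open>D\<close>.\<close>

lemma (in fraction_domain) subK_module_iff:
  "subK_module D I \<longleftrightarrow>
    0 \<in> I \<and> (\<forall>x\<in>I. \<forall>y\<in>I. x + y \<in> I) \<and> (\<forall>d\<in>D. \<forall>x\<in>I. d * x \<in> I)"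
proof -
  have "\<forall>x\<in>I. - x \<in> I" if "\<forall>d\<in>D. \<forall>x\<in>I. d * x \<in> I"
    using that[rule_format, of "-1"] uminus_mem[OF one_mem] by auto
  then show ?thesis
    unfolding subK_module_def additive_subgroup_ambient_iff by auto
qed

text \<open>Translates the library notion once, so that later arguments work with subsets of
  \<open>'k\<close> only.\<close>

lemma (in fraction_domain) ideal_ring_on_iff:
  "ideal I (ring_on D) \<longleftrightarrow> subK_module D I \<and> I \<subseteq> D"
proof
  assume I: "ideal I (ring_on D)"
  interpret I: ideal I "ring_on D" by fact
  show "subK_module D I \<and> I \<subseteq> D"
    using I.I_l_closed additive_subgroup.a_closed[OF I.is_additive_subgroup]
      additive_subgroup.zero_closed[OF I.is_additive_subgroup] I.a_subset by (auto simp: subK_module_iff)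
next
  assume I: "subK_module D I \<and> I \<subseteq> D"
  have ring: "ring (ring_on D)"
    using ring.subring_is_ring[OF ring_from_type_algebra subring_ambient] by simp
  show "ideal I (ring_on D)"
  proof (rule idealI[OF ring])
    interpret A: ring "ring_on D" by (rule ring)
    show "subgroup I (add_monoid (ring_on D))"
    proof (rule group.subgroupI)
      show "group (add_monoid (ring_on D))" by (rule A.add.is_group)
      show "inv\<^bsub>add_monoid (ring_on D)\<^esub> a \<in> I" if "a \<in> I" for a
      proof -
        have "a \<in> D" using that I by blast
        \<comment> \<open>The inverse in \<open>ring_on D\<close> is sought only within the carrier
          \<open>D\<close>, so it must be identified with the negative in \<open>'k\<close>.\<close>
        then have "\<ominus>\<^bsub>ring_on D\<^esub> a = - a"
          by (intro A.minus_equality) (auto intro: uminus_mem)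
        moreover have "- a \<in> I"
          using that I uminus_mem[OF one_mem] by (force simp: subK_module_iff)
        ultimately show ?thesis by (simp add: a_inv_def)
      qed
    qed (use I in \<open>auto simp: subK_module_iff\<close>)
    show "x \<otimes>\<^bsub>ring_on D\<^esub> a \<in> I" "a \<otimes>\<^bsub>ring_on D\<^esub> x \<in> I"
      if "a \<in> I" "x \<in> carrier (ring_on D)" for a x
      using I that by (auto simp: subK_module_iff mult.commute[of a x])
  qed
qed

text \<open>The zero ideal is allowed; \<open>t_Spec\<close> and \<open>t_Max\<close> exclude it
  through \<open>t_ideal\<close>.\<close>

definition prime_of :: "'k::field set \<Rightarrow> 'k set \<Rightarrow> bool"
  where "prime_of D P \<longleftrightarrow> subK_module D P \<and> P \<subset> D \<and>
    (\<forall>a\<in>D. \<forall>b\<in>D. a * b \<in> P \<longrightarrow> a \<in> P \<or> b \<in> P)"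

lemma (in fraction_domain) primeideal_prime_of:
  assumes "primeideal P (ring_on D)"
  shows "prime_of D P"
proof -
  interpret P: primeideal P "ring_on D" by fact
  show ?thesis
    using P.I_prime P.I_notcarr ideal_ring_on_iff[of P] P.ideal_axioms
    by (auto simp: prime_of_def)
qed

context fraction_domain
begin

lemma moduleD:
  assumes "subK_module D I"
  shows "0 \<in> I" "x \<in> I \<Longrightarrow> y \<in> I \<Longrightarrow> x + y \<in> I" "d \<in> D \<Longrightarrow> x \<in> I \<Longrightarrow> d * x \<in> I"
  using assms by (auto simp: subK_module_iff)

lemma moduleI:
  assumes "0 \<in> I" "\<And>x y. x \<in> I \<Longrightarrow> y \<in> I \<Longrightarrow> x + y \<in> I"
    "\<And>d x. d \<in> D \<Longrightarrow> x \<in> I \<Longrightarrow> d * x \<in> I"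
  shows "subK_module D I"
  using assms by (auto simp: subK_module_iff)

text \<open>Used to clear denominators, turning a fractional ideal into an integral one.\<close>

lemma module_scale:
  assumes I: "subK_module D I"
  shows "subK_module D ((*) d ` I)"
proof (rule moduleI)
  show "0 \<in> (*) d ` I" using moduleD(1)[OF I] by force
  show "x + y \<in> (*) d ` I" if "x \<in> (*) d ` I" "y \<in> (*) d ` I" for x y
    using that moduleD(2)[OF I] by (auto simp: distrib_left[symmetric])
  show "e * x \<in> (*) d ` I" if "e \<in> D" "x \<in> (*) d ` I" for e x
    using that moduleD(3)[OF I] by (auto simp: mult.left_commute[of e])
qed

lemma module_self: "subK_module D D"
  by (intro moduleI zero_mem add_mem mult_mem)

lemma module_nonzero:
  assumes "subK_module D I" "I \<noteq> {0}"
  obtains x where "x \<in> I" "x \<noteq> 0"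
  using assms moduleD(1) by blast

lemma fractional_ideal_sub: "subK_module D I \<Longrightarrow> I \<subseteq> D \<Longrightarrow> fractional_ideal D I"
  unfolding fractional_ideal_def using one_mem by (intro conjI bexI[of _ 1]) auto

lemma module_colon: "subK_module D (colon D I)"
  by (rule moduleI) (auto simp: colon_def zero_mem add_mem mult_mem distrib_right mult.assoc)

end

subsection \<open>Divisorial closure and t-ideals\<close>

lemma colon_antimono: "I \<subseteq> J \<Longrightarrow> colon D J \<subseteq> colon D I"
  by (auto simp: colon_def)

lemma subset_v_closure: "I \<subseteq> v_closure D I"
  by (auto simp: v_closure_def colon_def mult.commute)

lemma v_closure_mono: "I \<subseteq> J \<Longrightarrow> v_closure D I \<subseteq> v_closure D J"
  by (simp add: v_closure_def colon_antimono)

text \<open>\<open>colon D\<close> is an order-reversing Galois connection with itself, so three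
  applications agree with one.\<close>

lemma colon_v_closure: "colon D (v_closure D I) = colon D I"
proof
  show "colon D (v_closure D I) \<subseteq> colon D I" by (intro colon_antimono subset_v_closure)
  show "colon D I \<subseteq> colon D (v_closure D I)"
    using subset_v_closure[of "colon D I" D] by (simp add: v_closure_def)
qed

lemma v_closure_idem: "v_closure D (v_closure D I) = v_closure D I"
  using colon_v_closure[of D I] by (simp add: v_closure_def)

lemma v_closure_eq_colon: "colon D I = colon D J \<Longrightarrow> v_closure D I = v_closure D J"
  by (simp add: v_closure_def)

text \<open>If \<open>y\<close> multiplies \<open>d I\<close> into \<open>D\<close>, then
  \<open>y * d\<close> lies in \<open>colon D I\<close>, where membership of \<open>x\<close> can be
  tested.\<close>

lemma v_closure_scale:
  assumes "x \<in> v_closure D I"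
  shows "d * x \<in> v_closure D ((*) d ` I)"
proof -
  have "d * x * y \<in> D" if "y \<in> colon D ((*) d ` I)" for y
  proof -
    have "y * d \<in> colon D I" using that by (auto simp: colon_def mult.assoc)
    then have "x * (y * d) \<in> D"
      using assms unfolding v_closure_def colon_def[of D "colon D I"] by blast
    then show ?thesis by (simp add: ac_simps)
  qed
  then show ?thesis unfolding v_closure_def colon_def[of D "colon D _"] by blast
qed

context fraction_domain
begin

lemma colon_sub:
  assumes "I \<subseteq> D"
  shows "1 \<in> colon D I" "v_closure D I \<subseteq> D"
proof -
  show one: "1 \<in> colon D I" using assms by (auto simp: colon_def)
  show "v_closure D I \<subseteq> D"
  proof
    fix x assume "x \<in> v_closure D I"
    then have "x * 1 \<in> D" using one unfolding v_closure_def colon_def[of D "colon D I"] by blast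
    then show "x \<in> D" by simp
  qed
qed

text \<open>A nonzero \<open>x\<close> in \<open>I\<close>, scaled into \<open>D\<close>, is a
  common denominator of the inverse.\<close>

lemma fractional_colon:
  assumes "x \<in> I" "x \<noteq> 0"
  shows "fractional_ideal D (colon D I)"
proof -
  obtain d where d: "d \<in> D" "d \<noteq> 0" "d * x \<in> D" using denominator by blast
  have "d * x * y \<in> D" if "y \<in> colon D I" for y
    using that assms mult_mem[OF d(1), of "y * x"] by (auto simp: colon_def ac_simps)
  then show ?thesis
    unfolding fractional_ideal_def using module_colon d assms
    by (intro conjI bexI[of _ "d * x"]) auto
qed

lemma colon_nonzero:
  assumes "fractional_ideal D I"
  obtains d where "d \<in> colon D I" "d \<noteq> 0"
  using assms by (auto simp: fractional_ideal_def colon_def)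

lemma fractional_colon_ideal:
  assumes "fractional_ideal D I" "I \<noteq> {0}"
  shows "fractional_ideal D (colon D I)" "colon D I \<noteq> {0}"
proof -
  obtain x where "x \<in> I" "x \<noteq> 0"
    using module_nonzero assms fractional_ideal_def by metis
  then show "fractional_ideal D (colon D I)" by (rule fractional_colon)
  show "colon D I \<noteq> {0}" using colon_nonzero[OF assms(1)] by blast
qed

section \<open>Finitely generated submodules and t-ideals\<close>

lemma module_hull: "subK_module D (subK_module D hull S)"
  by (rule hull_in) (auto simp: subK_module_iff)

text \<open>The elements that a fixed \<open>x\<close> multiplies into \<open>D\<close> form a
  submodule. Hence inverses and v-closures of finitely generated ideals can be computed from finite
  sets of generators.\<close>

lemma colon_hull: "colon D (subK_module D hull S) = colon D S"
proof
  show "colon D (subK_module D hull S) \<subseteq> colon D S" by (intro colon_antimono hull_subset)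
  show "colon D S \<subseteq> colon D (subK_module D hull S)"
  proof
    fix x assume x: "x \<in> colon D S"
    have "subK_module D {y. x * y \<in> D}"
      by (rule moduleI)
        (auto simp: zero_mem add_mem distrib_left mult.left_commute intro: mult_mem)
    moreover have "S \<subseteq> {y. x * y \<in> D}" using x by (auto simp: colon_def)
    ultimately have "subK_module D hull S \<subseteq> {y. x * y \<in> D}" by (intro hull_minimal)
    then show "x \<in> colon D (subK_module D hull S)" by (auto simp: colon_def)
  qed
qed

lemma v_closure_hull: "v_closure D (subK_module D hull S) = v_closure D S"
  by (simp add: v_closure_def colon_hull)

lemma finite_denominator:
  assumes "finite F"
  shows "\<exists>d\<in>D. d \<noteq> 0 \<and> (\<forall>x\<in>F. d * x \<in> D)"
  using assms
proof induction
  case empty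
  then show ?case using one_mem by (intro bexI[of _ 1]) auto
next
  case (insert x F)
  then obtain d where d: "d \<in> D" "d \<noteq> 0" "\<forall>x\<in>F. d * x \<in> D" by blast
  obtain e where e: "e \<in> D" "e \<noteq> 0" "e * x \<in> D" using denominator by blast
  show ?case
  proof (intro bexI[of _ "d * e"] conjI ballI)
    fix y assume "y \<in> insert x F"
    then show "d * e * y \<in> D"
      using d(1,3) e(1,3) mult_mem[of d "e * x"] mult_mem[of e "d * y"] by (auto simp: ac_simps)
  qed (use d e in \<open>auto intro: mult_mem\<close>)
qed

lemma fractional_hull:
  assumes "finite F"
  shows "fractional_ideal D (subK_module D hull F)"
proof -
  obtain d where d: "d \<in> D" "d \<noteq> 0" "\<forall>x\<in>F. d * x \<in> D" using finite_denominator assms by blast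
  then have "d \<in> colon D (subK_module D hull F)" by (simp add: colon_hull) (simp add: colon_def)
  then show ?thesis using d module_hull by (auto simp: fractional_ideal_def colon_def)
qed

text \<open>Replaces finitely generated ideals by finite sets via \<open>v_closure_hull\<close>. All
  later work with t-ideals uses this finite condition.\<close>

lemma t_ideal_iff:
  "t_ideal D I \<longleftrightarrow> fractional_ideal D I \<and> I \<noteq> {0} \<and> (\<forall>F. finite F \<and> F \<subseteq> I \<longrightarrow> v_closure D F \<subseteq> I)"
proof (cases "fractional_ideal D I \<and> I \<noteq> {0}")
  case True
  then have I: "subK_module D I" by (auto simp: fractional_ideal_def)
  then obtain y where y: "y \<in> I" "y \<noteq> 0" using module_nonzero True by metis
  have hull_I: "subK_module D hull F \<subseteq> I" if "F \<subseteq> I" for F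
    using hull_minimal[of F I "subK_module D"] that I by blast
  have t: "v_closure D F \<subseteq> t_closure D I" if F: "finite F" "F \<subseteq> I" for F
  proof -
    \<comment> \<open>\<open>t_closure\<close> ranges over nonzero ideals only, while
      \<open>F\<close> may be empty or zero; adding \<open>y\<close> ensures that \<open>?J\<close>
      is nonzero.\<close>
    let ?J = "subK_module D hull (insert y F)"
    have "y \<in> ?J" by (simp add: hull_inc)
    then have "v_closure D ?J \<subseteq> t_closure D I"
      unfolding t_closure_def finitely_generated_def
      using F y fractional_hull[of "insert y F"] hull_I[of "insert y F"] by blast
    then show ?thesis using v_closure_mono[of F "insert y F" D] by (auto simp: v_closure_hull)
  qed
  have "I \<subseteq> t_closure D I"
  proof
    fix x assume "x \<in> I"
    then show "x \<in> t_closure D I" using t[of "{x}"] subset_v_closure[of "{x}" D] by blast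
  qed
  moreover have "t_closure D I \<subseteq> I \<longleftrightarrow> (\<forall>F. finite F \<and> F \<subseteq> I \<longrightarrow> v_closure D F \<subseteq> I)"
  proof
    assume "t_closure D I \<subseteq> I"
    then show "\<forall>F. finite F \<and> F \<subseteq> I \<longrightarrow> v_closure D F \<subseteq> I" using t by blast
  next
    assume r: "\<forall>F. finite F \<and> F \<subseteq> I \<longrightarrow> v_closure D F \<subseteq> I"
    show "t_closure D I \<subseteq> I"
    proof
      fix x assume "x \<in> t_closure D I"
      then obtain F where F: "finite F" "subK_module D hull F \<subseteq> I"
        "x \<in> v_closure D (subK_module D hull F)"
        unfolding t_closure_def finitely_generated_def by blast
      then show "x \<in> I" using r hull_subset[of F "subK_module D"] by (auto simp: v_closure_hull)
    qed
  qed
  ultimately show ?thesis using True by (auto simp: t_ideal_def)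
qed (auto simp: t_ideal_def)

lemma t_idealD:
  assumes "t_ideal D I"
  shows "subK_module D I" "fractional_ideal D I" "I \<noteq> {0}"
    "finite F \<Longrightarrow> F \<subseteq> I \<Longrightarrow> v_closure D F \<subseteq> I"
  using assms by (auto simp: t_ideal_iff fractional_ideal_def)

section \<open>Existence and primality of t-maximal ideals\<close>

lemma proper_iff_one_notin:
  assumes "subK_module D I"
  shows "I \<subset> D \<longleftrightarrow> I \<subseteq> D \<and> 1 \<notin> I"
  using moduleD(3)[OF assms, of _ 1] one_mem by fastforce

text \<open>Zorn's lemma applies because the condition of being a t-ideal concerns finite subsets,
  and a finite subset of the union of a chain lies in one member. Properness survives because 1 is
  in no member.\<close>

lemma t_ideal_subset_t_Max:
  assumes "t_ideal D P" "P \<subset> D"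
  shows "\<exists>M\<in>t_Max D. P \<subseteq> M"
proof -
  define A where "A = {J. t_ideal D J \<and> J \<subset> D \<and> P \<subseteq> J}"
  have "\<exists>M\<in>A. \<forall>U\<in>A. M \<subseteq> U \<longrightarrow> U = M"
  proof (rule subset_Zorn_nonempty)
    show "A \<noteq> {}" using assms by (auto simp: A_def)
    fix C assume C: "C \<noteq> {}" "subset.chain A C"
    have CA: "t_ideal D U" "U \<subset> D" "P \<subseteq> U" if "U \<in> C" for U
      using C that by (auto simp: subset.chain_def A_def)
    have lin: "U \<subseteq> V \<or> V \<subseteq> U" if "U \<in> C" "V \<in> C" for U V
      using C(2) that by (auto simp: subset.chain_def)
    have mod: "subK_module D (\<Union>C)"
    proof (rule moduleI)
      show "0 \<in> \<Union>C" using C(1) CA(1) t_idealD(1) moduleD(1) by blast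
      show "d * x \<in> \<Union>C" if "d \<in> D" "x \<in> \<Union>C" for d x
        using that CA(1) t_idealD(1) moduleD(3) by blast
      show "x + y \<in> \<Union>C" if xy: "x \<in> \<Union>C" "y \<in> \<Union>C" for x y
      proof -
        obtain U V where UV: "U \<in> C" "x \<in> U" "V \<in> C" "y \<in> V" using xy by blast
        then obtain Z where "Z \<in> C" "x \<in> Z" "y \<in> Z" using lin[of U V] by blast
        then show ?thesis using CA(1) t_idealD(1) moduleD(2) by blast
      qed
    qed
    have sub: "\<Union>C \<subseteq> D" using CA by blast
    have "1 \<notin> U" if "U \<in> C" for U
      using CA(2)[OF that] proper_iff_one_notin[OF t_idealD(1)[OF CA(1)[OF that]]] by blast
    then have "1 \<notin> \<Union>C" by blast
    moreover have "t_ideal D (\<Union>C)"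
      unfolding t_ideal_iff
    proof (intro conjI allI impI)
      show "fractional_ideal D (\<Union>C)" using fractional_ideal_sub mod sub by blast
      show "\<Union>C \<noteq> {0}"
        using C(1) CA(1)[THEN t_idealD(3)] CA(1)[THEN t_idealD(1), THEN moduleD(1)] by blast
      fix F assume F: "finite F \<and> F \<subseteq> \<Union>C"
      obtain U where "U \<in> C" "F \<subseteq> U"
        using finite_subset_Union_chain[of F C A] F C by blast
      then show "v_closure D F \<subseteq> \<Union>C" using t_idealD(4)[OF CA(1)] F by blast
    qed
    ultimately show "\<Union>C \<in> A"
      using C(1) CA(3) proper_iff_one_notin[OF mod] sub unfolding A_def by blast
  qed
  then obtain M where MA: "M \<in> A" and max: "\<forall>U\<in>A. M \<subseteq> U \<longrightarrow> U = M" ..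
  have M: "t_ideal D M" "M \<subset> D" "P \<subseteq> M" using MA by (simp_all add: A_def)
  have *: "J = M" if J: "t_ideal D J" "J \<subset> D" "M \<subseteq> J" for J
  proof -
    have "J \<in> A" using J subset_trans[OF M(3) J(3)] by (simp add: A_def)
    then show ?thesis using max J(3) by simp
  qed
  have "M \<in> t_Max D" unfolding t_Max_def mem_Collect_eq using M(1,2) * by blast
  then show ?thesis using M(3) by (rule bexI[rotated])
qed

lemma t_MaxD:
  assumes "M \<in> t_Max D"
  shows "t_ideal D M" "M \<subset> D" "t_ideal D J \<Longrightarrow> J \<subset> D \<Longrightarrow> M \<subseteq> J \<Longrightarrow> J = M"
  using assms by (auto simp: t_Max_def)

text \<open>For \<open>b\<close> in \<open>D\<close>, the ideal $(M:b) \cap D$ is a $t$-ideal containing \<open>M\<close>.\<close>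

lemma t_Max_prime:
  assumes M: "M \<in> t_Max D"
  shows "prime_of D M"
  unfolding prime_of_def
proof (intro conjI ballI impI)
  note tM = t_MaxD(1)[OF M] and pM = t_MaxD(2)[OF M]
  note mM = moduleD[OF t_idealD(1)[OF tM]]
  show "subK_module D M" "M \<subset> D" using t_idealD(1) tM pM by blast+
  fix a b assume ab: "a \<in> D" "b \<in> D" "a * b \<in> M"
  let ?J = "{x \<in> D. b * x \<in> M}"
  have mod: "subK_module D ?J"
    using mM by (intro moduleI)
      (auto simp: zero_mem add_mem mult_mem distrib_left mult.left_commute)
  have MJ: "M \<subseteq> ?J" using mM ab pM by auto
  have "t_ideal D ?J"
    unfolding t_ideal_iff
  proof (intro conjI allI impI)
    show "fractional_ideal D ?J" using mod by (rule fractional_ideal_sub) auto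
    obtain m where "m \<in> M" "m \<noteq> 0"
      using module_nonzero[OF t_idealD(1)[OF tM] t_idealD(3)[OF tM]] by blast
    then show "?J \<noteq> {0}" using MJ by blast
    fix F assume F: "finite F \<and> F \<subseteq> ?J"
    show "v_closure D F \<subseteq> ?J"
    proof
      fix x assume x: "x \<in> v_closure D F"
      have "x \<in> D" using x colon_sub(2)[of F] F by blast
      moreover have "b * x \<in> v_closure D ((*) b ` F)"
        using x by (rule v_closure_scale)
      then have "b * x \<in> M" using t_idealD(4)[OF tM, of "(*) b ` F"] F by blast
      ultimately show "x \<in> ?J" by blast
    qed
  qed
  \<comment> \<open>In the first case \<open>a\<close>, which lies in \<open>?J\<close>, is in
    \<open>M\<close>. In the second, 1 lies in \<open>?J\<close>, so \<open>b\<close> is in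
    \<open>M\<close>.\<close>
  then have "?J = M \<or> ?J = D" using t_MaxD(3)[OF M _ _ MJ] by blast
  then show "a \<in> M \<or> b \<in> M"
  proof
    assume "?J = M"
    then show ?thesis using ab by (auto simp: mult.commute)
  next
    assume "?J = D"
    then have "1 \<in> ?J" using one_mem by simp
    then show ?thesis by simp
  qed
qed

end

subsection \<open>Localization\<close>

text \<open>For a prime \<open>P\<close> and a submodule \<open>I\<close> this is the extension of
  \<open>I\<close> to \<open>loc D P\<close>, as \<open>ideal_prod_loc\<close> shows; membership
  needs a single witness instead of a sum of products.\<close>

definition localized :: "'k::field set \<Rightarrow> 'k set \<Rightarrow> 'k set \<Rightarrow> 'k set"
  where "localized D P I = {x. \<exists>s\<in>D. s \<notin> P \<and> s * x \<in> I}"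

lemma localizedI: "s \<in> D \<Longrightarrow> s \<notin> P \<Longrightarrow> s * x \<in> I \<Longrightarrow> x \<in> localized D P I"
  by (auto simp: localized_def)

lemma localizedE:
  assumes "x \<in> localized D P I"
  obtains s where "s \<in> D" "s \<notin> P" "s * x \<in> I"
  using assms by (auto simp: localized_def)

lemma localized_scale:
  assumes "x \<in> localized D P I" "\<And>y. y \<in> I \<Longrightarrow> d * y \<in> J"
  shows "d * x \<in> localized D P J" "x * d \<in> localized D P J"
proof -
  obtain s where s: "s \<in> D" "s \<notin> P" "s * x \<in> I" using assms(1) by (rule localizedE)
  then have "d * (s * x) \<in> J" using assms(2) by blast
  then show "d * x \<in> localized D P J" using s by (intro localizedI[of s]) (simp_all add: ac_simps)
  then show "x * d \<in> localized D P J" by (simp add: mult.commute)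
qed

lemma localized_mono: "I \<subseteq> J \<Longrightarrow> localized D P I \<subseteq> localized D P J"
  by (auto simp: localized_def)

lemma localized_antimono_prime: "P \<subseteq> Q \<Longrightarrow> localized D Q I \<subseteq> localized D P I"
  by (auto simp: localized_def)

locale prime_in_domain = fraction_domain D for D :: "'k::field set" +
  fixes P :: "'k set"
  assumes prime: "prime_of D P"
begin

lemma prime_module: "subK_module D P" and prime_sub: "P \<subseteq> D"
  using prime by (auto simp: prime_of_def)

lemma one_notin_prime: "1 \<notin> P"
  using prime proper_iff_one_notin by (auto simp: prime_of_def)

lemma zero_in_prime: "0 \<in> P"
  using prime_module moduleD by blast

lemma mult_notin_prime: "s \<in> D \<Longrightarrow> s \<notin> P \<Longrightarrow> t \<in> D \<Longrightarrow> t \<notin> P \<Longrightarrow> s * t \<notin> P"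
  using prime by (auto simp: prime_of_def)

lemma loc_eq_localized: "loc D P = localized D P D"
proof
  show "loc D P \<subseteq> localized D P D"
  proof
    fix x assume "x \<in> loc D P"
    then obtain a s where *: "a \<in> D" "s \<in> D" "s \<notin> P" "x = a / s" by (auto simp: loc_def)
    then show "x \<in> localized D P D"
      using zero_in_prime by (intro localizedI[of s]) auto
  qed
  show "localized D P D \<subseteq> loc D P"
  proof
    fix x assume "x \<in> localized D P D"
    then obtain s where *: "s \<in> D" "s \<notin> P" "s * x \<in> D" by (rule localizedE)
    then have "x = (s * x) / s" using zero_in_prime by auto
    then show "x \<in> loc D P" using * unfolding loc_def by blast
  qed
qed

lemma inverse_in_loc: "s \<in> D \<Longrightarrow> s \<notin> P \<Longrightarrow> inverse s \<in> loc D P"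
  using one_mem zero_in_prime
  by (cases "s = 0") (auto simp: loc_eq_localized intro!: localizedI[of s])

lemma localized_add:
  assumes I: "subK_module D I" and "x \<in> localized D P I" "y \<in> localized D P I"
  shows "x + y \<in> localized D P I"
proof -
  obtain s where s: "s \<in> D" "s \<notin> P" "s * x \<in> I" using assms by (auto elim: localizedE)
  obtain t where t: "t \<in> D" "t \<notin> P" "t * y \<in> I" using assms by (auto elim: localizedE)
  have "t * (s * x) + s * (t * y) \<in> I"
    using s t moduleD[OF I] by blast
  then show ?thesis
    using s t mult_notin_prime mult_mem
    by (intro localizedI[of "s * t"]) (auto simp: algebra_simps)
qed

lemma localized_mult:
  assumes "x \<in> localized D P I" "d \<in> localized D P E" "\<And>e y. e \<in> E \<Longrightarrow> y \<in> I \<Longrightarrow> e * y \<in> I"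
  shows "d * x \<in> localized D P I"
proof -
  obtain s where s: "s \<in> D" "s \<notin> P" "s * x \<in> I" using assms by (auto elim: localizedE)
  obtain t where t: "t \<in> D" "t \<notin> P" "t * d \<in> E" using assms by (auto elim: localizedE)
  have "(t * d) * (s * x) \<in> I" using s t assms(3) by blast
  then show ?thesis
    using s t mult_notin_prime mult_mem
    by (intro localizedI[of "s * t"]) (auto simp: ac_simps)
qed

lemma subset_localized: "I \<subseteq> localized D P I"
  using one_mem one_notin_prime by (auto intro: localizedI[of 1])

lemma fraction_domain_loc: "fraction_domain (loc D P)"
proof
  have DL: "D \<subseteq> loc D P" using subset_localized loc_eq_localized by blast
  show "0 \<in> loc D P" "1 \<in> loc D P" using zero_mem one_mem DL by auto
  show "\<exists>d\<in>loc D P. d \<noteq> 0 \<and> d * x \<in> loc D P" for x using denominator[of x] DL by blast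
  show mul: "x * y \<in> loc D P" if "x \<in> loc D P" "y \<in> loc D P" for x y
    using that localized_mult[of y D x D] mult_mem by (auto simp: loc_eq_localized)
  show "x + y \<in> loc D P" if "x \<in> loc D P" "y \<in> loc D P" for x y
    using that localized_add module_self by (auto simp: loc_eq_localized)
  show "- x \<in> loc D P" if "x \<in> loc D P" for x
    using mul[of "-1" x] that DL uminus_mem[OF one_mem] by auto
qed

sublocale L: fraction_domain "loc D P"
  by (rule fraction_domain_loc)

lemma module_localized:
  assumes "subK_module D I"
  shows "subK_module (loc D P) (localized D P I)"
  using moduleD[OF assms] subset_localized[of I] localized_add[OF assms] localized_mult[of _ I _ D]
  by (intro L.moduleI) (auto simp: loc_eq_localized)

text \<open>Common denominators collapse every finite sum of products to a single product of
  \<open>s * x\<close> with \<open>inverse s\<close>.\<close>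

lemma ideal_prod_loc:
  assumes I: "subK_module D I"
  shows "ideal_prod ambient I (loc D P) = localized D P I"
proof
  show "ideal_prod ambient I (loc D P) \<subseteq> localized D P I"
  proof
    fix x assume "x \<in> ideal_prod ambient I (loc D P)"
    then show "x \<in> localized D P I"
    proof induction
      case (prod i j)
      then show ?case
        using L.moduleD(3)[OF module_localized[OF I], of j i] subset_localized[of I]
        by (auto simp: mult.commute)
    next
      case (sum s1 s2)
      then show ?case using localized_add[OF I] by simp
    qed
  qed
  show "localized D P I \<subseteq> ideal_prod ambient I (loc D P)"
  proof
    fix x assume "x \<in> localized D P I"
    then obtain s where s: "s \<in> D" "s \<notin> P" "s * x \<in> I" by (rule localizedE)
    then have "(s * x) \<otimes>\<^bsub>ambient\<^esub> inverse s \<in> ideal_prod ambient I (loc D P)"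
      by (intro ideal_prod.prod inverse_in_loc)
    then show "x \<in> ideal_prod ambient I (loc D P)"
      using s zero_in_prime by (simp add: ac_simps) (metis mult.left_commute mult_1_right right_inverse)
  qed
qed

text \<open>Elements of \<open>D\<close> outside \<open>P\<close> are units of
  \<open>loc D P\<close>, so numerators already lie in \<open>J\<close> and every ideal is extended
  from its contraction.\<close>

lemma localized_contraction:
  assumes J: "subK_module (loc D P) J" and "J \<subseteq> loc D P"
  shows "localized D P (J \<inter> D) = J"
proof
  show "J \<subseteq> localized D P (J \<inter> D)"
  proof
    fix x assume x: "x \<in> J"
    then obtain s where "s \<in> D" "s \<notin> P" "s * x \<in> D"
      using assms(2) by (auto simp: loc_eq_localized elim: localizedE)
    then show "x \<in> localized D P (J \<inter> D)"
      using L.moduleD(3)[OF J _ x, of s] subset_localized[of D]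
      by (intro localizedI[of s]) (auto simp: loc_eq_localized)
  qed
  show "localized D P (J \<inter> D) \<subseteq> J"
  proof
    fix x assume "x \<in> localized D P (J \<inter> D)"
    then obtain s where s: "s \<in> D" "s \<notin> P" "s * x \<in> J" by (auto elim: localizedE)
    then have "inverse s * (s * x) \<in> J" using L.moduleD(3)[OF J inverse_in_loc] by blast
    moreover have "s \<noteq> 0" using s zero_in_prime by blast
    ultimately show "x \<in> J" by (simp add: mult.assoc[symmetric])
  qed
qed

lemma contraction_module:
  assumes J: "subK_module (loc D P) J"
  shows "subK_module D (J \<inter> D)"
  using L.moduleD[OF J] subset_localized[of D]
  by (intro moduleI) (auto simp: zero_mem add_mem mult_mem loc_eq_localized)

lemma common_denominator:
  assumes "finite F" "\<forall>f\<in>F. x * f \<in> localized D P I" and I: "subK_module D I"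
  shows "\<exists>s\<in>D. s \<notin> P \<and> (\<forall>f\<in>F. s * x * f \<in> I)"
  using assms(1,2)
proof induction
  case empty
  then show ?case using one_mem one_notin_prime by blast
next
  case (insert g F)
  then obtain s where s: "s \<in> D" "s \<notin> P" "\<forall>f\<in>F. s * x * f \<in> I" by blast
  obtain t where t: "t \<in> D" "t \<notin> P" "t * (x * g) \<in> I" using insert by (auto elim: localizedE)
  show ?case
  proof (intro bexI[of _ "s * t"] conjI ballI)
    fix f assume f: "f \<in> insert g F"
    have "t * (s * x * f) \<in> I" if "f \<in> F" using that s t moduleD(3)[OF I] by blast
    moreover have "s * (t * (x * g)) \<in> I" using s t moduleD(3)[OF I] by blast
    ultimately show "s * t * x * f \<in> I" using f by (auto simp: ac_simps)
  qed (use s t mult_notin_prime mult_mem in auto)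
qed

text \<open>The denominators used to form the extension are units of \<open>loc D P\<close> and can
  be cancelled.\<close>

lemma colon_loc_localized:
  "colon (loc D P) (localized D P I) = colon (loc D P) I"
proof
  show "colon (loc D P) (localized D P I) \<subseteq> colon (loc D P) I"
    by (intro colon_antimono subset_localized)
  show "colon (loc D P) I \<subseteq> colon (loc D P) (localized D P I)"
  proof
    fix x assume x: "x \<in> colon (loc D P) I"
    have "x * y \<in> loc D P" if y: "y \<in> localized D P I" for y
    proof -
      obtain s where s: "s \<in> D" "s \<notin> P" "s * y \<in> I" using y by (rule localizedE)
      then have "x * (s * y) \<in> loc D P" using x by (auto simp: colon_def)
      then have "inverse s * (x * (s * y)) \<in> loc D P"
        using inverse_in_loc s L.mult_mem by blast
      moreover have "s \<noteq> 0" using s zero_in_prime by blast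
      then have "inverse s * (x * (s * y)) = x * y" by (simp add: field_simps)
      ultimately show ?thesis by simp
    qed
    then show "x \<in> colon (loc D P) (localized D P I)" by (auto simp: colon_def)
  qed
qed

lemma localized_colon_subset: "localized D P (colon D I) \<subseteq> colon (loc D P) I"
proof
  fix x assume x: "x \<in> localized D P (colon D I)"
  have "x * y \<in> localized D P D" if "y \<in> I" for y
    using x by (rule localized_scale(2)) (use that in \<open>auto simp: colon_def mult.commute\<close>)
  then show "x \<in> colon (loc D P) I" by (simp add: colon_def loc_eq_localized)
qed

text \<open>Finiteness supplies one denominator for all products \<open>x * f\<close>, which gives
  the inclusion missing from \<open>localized_colon_subset\<close>.\<close>

lemma localized_colon_finite:
  assumes "finite F"
  shows "localized D P (colon D F) = colon (loc D P) F"
proof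
  show "localized D P (colon D F) \<subseteq> colon (loc D P) F" by (rule localized_colon_subset)
  show "colon (loc D P) F \<subseteq> localized D P (colon D F)"
  proof
    fix x assume "x \<in> colon (loc D P) F"
    then obtain s where "s \<in> D" "s \<notin> P" "\<forall>f\<in>F. s * x * f \<in> D"
      using common_denominator[OF assms _ module_self, of x] by (auto simp: colon_def loc_eq_localized)
    then show "x \<in> localized D P (colon D F)" by (intro localizedI[of s]) (auto simp: colon_def)
  qed
qed

end

subsection \<open>Mori domains\<close>

text \<open>The finiteness property of Mori domains that passes to $t$-flat overrings.\<close>

definition v_finite :: "'k::field set \<Rightarrow> bool"
  where "v_finite D \<longleftrightarrow> (\<forall>I. subK_module D I \<and> I \<subseteq> D \<longrightarrow>
    (\<exists>F. finite F \<and> F \<subseteq> I \<and> colon D F = colon D I))"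

context fraction_domain
begin

text \<open>Clear denominators with \<open>d\<close>, apply the integral case and divide the finite
  set by \<open>d\<close> again.\<close>

lemma v_finite_fractional:
  assumes "v_finite D" and "fractional_ideal D I"
  obtains F where "finite F" "F \<subseteq> I" "colon D F = colon D I"
proof -
  obtain d where d: "d \<in> D" "d \<noteq> 0" "\<forall>x\<in>I. d * x \<in> D" and I: "subK_module D I"
    using assms by (auto simp: fractional_ideal_def)
  have "subK_module D ((*) d ` I)" using I by (rule module_scale)
  moreover have "(*) d ` I \<subseteq> D" using d by auto
  ultimately obtain G where G: "finite G" "G \<subseteq> (*) d ` I" "colon D G = colon D ((*) d ` I)"
    using assms(1) by (auto simp: v_finite_def)
  then obtain F where F: "finite F" "F \<subseteq> I" "G = (*) d ` F"
    by (meson finite_subset_image)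
  have scale: "x \<in> colon D A \<longleftrightarrow> x / d \<in> colon D ((*) d ` A)" for x A
    using d by (auto simp: colon_def)
  have "colon D F = colon D I" using scale G(3) F(3) by blast
  with F show ?thesis using that by blast
qed

text \<open>If the chain $F_n$ of finite subsets of \<open>I\<close> could be continued forever with strictly decreasing
  inverses, the divisorial ideals $(F_n)_v$ would contradict the Mori property.\<close>

lemma Mori_v_finite:
  assumes "Mori D"
  shows "v_finite D"
  unfolding v_finite_def
proof (intro allI impI, rule ccontr)
  fix I assume I: "subK_module D I \<and> I \<subseteq> D"
    and no: "\<not> (\<exists>F. finite F \<and> F \<subseteq> I \<and> colon D F = colon D I)"
  have "I \<noteq> {0}" using no by blast
  \<comment> \<open>\<open>x0\<close> is kept in every member of the chain so that the v-closures
    are nonzero.\<close>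
  then obtain x0 where x0: "x0 \<in> I" "x0 \<noteq> 0" using I module_nonzero by metis
  let ?p = "\<lambda>_::nat. \<lambda>F. finite F \<and> x0 \<in> F \<and> F \<subseteq> I"
  have "\<exists>F. \<forall>n. ?p n (F n) \<and> (F n \<subseteq> F (Suc n) \<and> colon D (F n) \<noteq> colon D (F (Suc n)))"
  proof (rule dependent_nat_choice)
    show "\<exists>F. ?p 0 F" using x0 by (intro exI[of _ "{x0}"]) auto
    fix F n assume F: "?p n F"
    then have "colon D F \<noteq> colon D I" "colon D I \<subseteq> colon D F"
      using no colon_antimono[of F I] by auto
    then obtain y where y: "y \<in> colon D F" "y \<notin> colon D I" by blast
    then obtain z where z: "z \<in> I" "y * z \<notin> D" by (auto simp: colon_def)
    then have "y \<notin> colon D (insert z F)" by (auto simp: colon_def)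
    then show "\<exists>G. ?p (Suc n) G \<and> (F \<subseteq> G \<and> colon D F \<noteq> colon D G)"
      using F y z by (intro exI[of _ "insert z F"]) auto
  qed
  then obtain F where F: "\<And>n. ?p n (F n)" "\<And>n. F n \<subseteq> F (Suc n)"
    "\<And>n. colon D (F n) \<noteq> colon D (F (Suc n))" by blast
  let ?V = "\<lambda>n. v_closure D (F n)"
  have "divisorial_ideal D (?V n) \<and> ?V n \<subset> D \<and> ?V n \<subseteq> ?V (Suc n)" for n
  proof (intro conjI)
    have FD: "F n \<subseteq> D" using F(1)[of n] I by blast
    have VD: "?V n \<subseteq> D" using colon_sub(2)[OF FD] .
    have mV: "subK_module D (?V n)" by (simp add: v_closure_def module_colon)
    have "x0 \<in> ?V n" using F(1)[of n] subset_v_closure by blast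
    then show "divisorial_ideal D (?V n)"
      unfolding divisorial_ideal_def using x0 fractional_ideal_sub[OF mV VD] by (auto simp: v_closure_idem)
    \<comment> \<open>If 1 were in the closure, the inverse of \<open>F n\<close> would lie in
      \<open>D\<close>, hence in the inverse of \<open>I\<close>; then \<open>F n\<close> would be a
      set excluded by \<open>no\<close>.\<close>
    have "?V n \<noteq> D"
    proof
      assume "?V n = D"
      then have "1 \<in> ?V n" using one_mem by simp
      then have sub: "colon D (F n) \<subseteq> D" by (auto simp: v_closure_def colon_def)
      have "colon D (F n) \<subseteq> colon D I"
      proof
        fix x assume "x \<in> colon D (F n)"
        then have "x \<in> D" using sub by blast
        then show "x \<in> colon D I" using I mult_mem by (auto simp: colon_def)
      qed
      moreover have "colon D I \<subseteq> colon D (F n)" using F(1) colon_antimono by blast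
      ultimately show False using no F(1)[of n] by blast
    qed
    then show "?V n \<subset> D" using VD by blast
    show "?V n \<subseteq> ?V (Suc n)" using F(2) v_closure_mono by blast
  qed
  then have "\<exists>N. \<forall>n\<ge>N. ?V n = ?V N"
    by (intro assms[unfolded Mori_def, THEN spec, THEN mp] allI)
  then obtain N where N: "\<forall>n\<ge>N. ?V n = ?V N" ..
  have "?V (Suc N) = ?V N" by (rule N[rule_format]) simp
  then have "colon D (F (Suc N)) = colon D (F N)" using colon_v_closure by metis
  then show False using F(3)[of N] by simp
qed

lemma t_ideal_divisorial:
  assumes "divisorial_ideal D I"
  shows "t_ideal D I"
  using assms v_closure_mono unfolding divisorial_ideal_def t_ideal_iff by blast

text \<open>A finite \<open>F\<close> in \<open>I\<close> with the same inverse has the same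
  v-closure, which a t-ideal contains.\<close>

lemma v_closure_t_ideal:
  assumes "v_finite D" "t_ideal D I"
  shows "v_closure D I = I"
proof
  obtain F where F: "finite F" "F \<subseteq> I" "colon D F = colon D I"
    using v_finite_fractional assms t_idealD(2) by metis
  show "v_closure D I \<subseteq> I"
    using t_idealD(4)[OF assms(2) F(1,2)] v_closure_eq_colon[OF F(3)] by simp
qed (rule subset_v_closure)

lemma in_prime_t_Max: "M \<in> t_Max D \<Longrightarrow> prime_in_domain D M"
  using fraction_domain_axioms t_Max_prime by (simp add: prime_in_domain_def prime_in_domain_axioms_def)

text \<open>The denominators of \<open>x\<close> in \<open>D\<close> form the divisorial ideal
  \<open>colon D {1, x}\<close>. For \<open>x\<close> outside \<open>D\<close> it is proper, hence
  lies in some t-maximal \<open>M\<close>, and no denominator of \<open>x\<close> avoids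
  \<open>M\<close>.\<close>

lemma Inter_loc_t_Max:
  assumes "\<And>M. M \<in> t_Max D \<Longrightarrow> x \<in> loc D M"
  shows "x \<in> D"
proof (rule ccontr)
  assume x: "x \<notin> D"
  let ?I = "colon D {1, x}"
  obtain d where d: "d \<in> D" "d \<noteq> 0" "d * x \<in> D" using denominator by blast
  have I: "?I = {y \<in> D. y * x \<in> D}" by (auto simp: colon_def)
  have "divisorial_ideal D ?I"
    unfolding divisorial_ideal_def
    using fractional_colon[of 1 "{1, x}"] d I colon_v_closure[of D "{1, x}"]
    by (auto simp: v_closure_def)
  then have "t_ideal D ?I" by (rule t_ideal_divisorial)
  moreover have "1 \<notin> ?I" using x I by simp
  then have "?I \<subset> D" using I one_mem by blast
  ultimately obtain M where M: "M \<in> t_Max D" "?I \<subseteq> M" using t_ideal_subset_t_Max[of ?I] by blast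
  interpret M: prime_in_domain D M using in_prime_t_Max M by blast
  obtain s where "s \<in> D" "s \<notin> M" "s * x \<in> D"
    using assms[OF M(1)] by (auto simp: M.loc_eq_localized elim: localizedE)
  then show False using I M by blast
qed

section \<open>The w-closure and its localizations\<close>

lemma w_closure_eq:
  assumes "subK_module D I"
  shows "w_closure D I = (\<Inter>M\<in>t_Max D. localized D M I)"
  unfolding w_closure_def
  using prime_in_domain.ideal_prod_loc[OF in_prime_t_Max assms] by auto

lemma subset_w_closure:
  assumes "subK_module D I"
  shows "I \<subseteq> w_closure D I"
  using prime_in_domain.subset_localized[OF in_prime_t_Max] by (auto simp: w_closure_eq[OF assms])

lemma module_w_closure:
  assumes I: "subK_module D I"
  shows "subK_module D (w_closure D I)"
proof (rule moduleI)
  show "0 \<in> w_closure D I" using subset_w_closure[OF I] moduleD(1)[OF I] by blast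
  show "x + y \<in> w_closure D I" if "x \<in> w_closure D I" "y \<in> w_closure D I" for x y
    using that prime_in_domain.localized_add[OF in_prime_t_Max I]
    by (auto simp: w_closure_eq[OF I])
  show "d * x \<in> w_closure D I" if "d \<in> D" "x \<in> w_closure D I" for d x
    using that moduleD(3)[OF I]
    by (auto simp: w_closure_eq[OF I] localized_def) (metis mult.left_commute)
qed

text \<open>A denominator of \<open>I\<close> is one for each localization of \<open>I\<close>, and
  \<open>Inter_loc_t_Max\<close> makes this global.\<close>

lemma fractional_w_closure:
  assumes "fractional_ideal D I"
  shows "fractional_ideal D (w_closure D I)"
proof -
  obtain d where d: "d \<in> D" "d \<noteq> 0" "\<forall>x\<in>I. d * x \<in> D" and I: "subK_module D I"
    using assms by (auto simp: fractional_ideal_def)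
  have "d * x \<in> D" if x: "x \<in> w_closure D I" for x
  proof (rule Inter_loc_t_Max)
    fix M assume M: "M \<in> t_Max D"
    interpret M: prime_in_domain D M using in_prime_t_Max M by blast
    have "x \<in> localized D M I" using x M by (simp add: w_closure_eq[OF I])
    then show "d * x \<in> loc D M"
      using localized_scale(1)[of x D M I d D] d by (simp add: M.loc_eq_localized)
  qed
  then show ?thesis using d module_w_closure[OF I] by (auto simp: fractional_ideal_def)
qed

text \<open>The w-closure lies in the localization at \<open>M\<close>, hence in that at the smaller
  prime \<open>P\<close>, and localizing at \<open>P\<close> twice adds nothing.\<close>

lemma localized_w_closure:
  assumes I: "subK_module D I" and M: "M \<in> t_Max D" "P \<subseteq> M" and P: "prime_of D P"
  shows "localized D P (w_closure D I) = localized D P I"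
proof
  interpret prime_in_domain D P by unfold_locales (rule P)
  show "localized D P I \<subseteq> localized D P (w_closure D I)"
    by (intro localized_mono subset_w_closure I)
  have "w_closure D I \<subseteq> localized D M I" using M by (auto simp: w_closure_eq[OF I])
  also have "\<dots> \<subseteq> localized D P I" using M by (intro localized_antimono_prime)
  finally have sub: "w_closure D I \<subseteq> localized D P I" .
  show "localized D P (w_closure D I) \<subseteq> localized D P I"
  proof
    fix x assume "x \<in> localized D P (w_closure D I)"
    then obtain s where s: "s \<in> D" "s \<notin> P" "s * x \<in> localized D P I"
      using sub by (auto elim: localizedE)
    then obtain t where "t \<in> D" "t \<notin> P" "t * (s * x) \<in> I" by (auto elim: localizedE)
    then show "x \<in> localized D P I"
      using s mult_notin_prime mult_mem by (intro localizedI[of "t * s"]) (auto simp: ac_simps)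
  qed
qed

lemma w_ideal_w_closure:
  assumes I: "fractional_ideal D I" "I \<noteq> {0}"
  shows "w_ideal D (w_closure D I)"
proof -
  have m: "subK_module D I" using I by (auto simp: fractional_ideal_def)
  \<comment> \<open>Idempotence is \<open>localized_w_closure\<close> with \<open>P = M\<close>, at
    each t-maximal ideal.\<close>
  have "w_closure D (w_closure D I) = w_closure D I"
    unfolding w_closure_eq[OF module_w_closure[OF m]]
    using localized_w_closure[OF m] t_Max_prime by (auto simp: w_closure_eq[OF m])
  moreover obtain x where "x \<in> I" "x \<noteq> 0" using module_nonzero m I by metis
  then have "w_closure D I \<noteq> {0}" using subset_w_closure[OF m] by blast
  ultimately show ?thesis using fractional_w_closure[OF I(1)] by (simp add: w_ideal_def)
qed

end

section \<open>Divisoriality under localization\<close>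

lemma (in prime_in_domain) localized_colon:
  assumes "v_finite D" "fractional_ideal D I"
  shows "localized D P (colon D I) = colon (loc D P) (localized D P I)"
proof
  obtain F where F: "finite F" "F \<subseteq> I" "colon D F = colon D I"
    using v_finite_fractional assms by metis
  have "colon (loc D P) (localized D P I) \<subseteq> colon (loc D P) F"
    unfolding colon_loc_localized using F by (intro colon_antimono)
  then show "colon (loc D P) (localized D P I) \<subseteq> localized D P (colon D I)"
    using localized_colon_finite[OF F(1)] F(3) by simp
  show "localized D P (colon D I) \<subseteq> colon (loc D P) (localized D P I)"
    unfolding colon_loc_localized by (rule localized_colon_subset)
qed

text \<open>Two uses of \<open>localized_colon\<close>; the second needs the inverse of
  \<open>I\<close> to be a fractional ideal.\<close>

lemma (in prime_in_domain) localized_v_closure: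
  assumes "v_finite D" "fractional_ideal D I" "I \<noteq> {0}"
  shows "localized D P (v_closure D I) = v_closure (loc D P) (localized D P I)"
  unfolding v_closure_def
  using localized_colon assms fractional_colon_ideal by simp

text \<open>Stated for every prime below a t-maximal ideal, so that it serves t-primes of
  \<open>D\<close> and contractions from t-flat overrings as well as t-maximal ideals.\<close>

lemma (in prime_in_domain) divisorial_domain_loc:
  assumes "v_finite D" "w_divisorial D" "D \<noteq> UNIV" "M \<in> t_Max D" "P \<subseteq> M"
  shows "divisorial_domain (loc D P)"
  unfolding divisorial_domain_def
proof (intro allI impI)
  fix J assume J: "ideal J (ring_on (loc D P)) \<and> J \<noteq> {0}"
  then have J': "subK_module (loc D P) J" "J \<subseteq> loc D P" by (auto simp: L.ideal_ring_on_iff)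
  let ?A = "J \<inter> D"
  have A: "subK_module D ?A" "localized D P ?A = J"
    using contraction_module localized_contraction J' by auto
  have "fractional_ideal D ?A" using A(1) by (rule fractional_ideal_sub) auto
  moreover have "?A \<noteq> {0}"
  proof
    assume "?A = {0}"
    then have "J \<subseteq> {0}" using A(2) zero_in_prime by (auto simp: localized_def)
    then show False using J L.moduleD(1)[OF J'(1)] by blast
  qed
  ultimately have w: "w_ideal D (w_closure D ?A)" by (rule w_ideal_w_closure)
  then have "divisorial_ideal D (w_closure D ?A)" using assms by (auto simp: w_divisorial_def)
  moreover have "localized D P (w_closure D ?A) = J" using localized_w_closure A assms prime by simp
  ultimately have "v_closure (loc D P) J = J"
    using localized_v_closure[of "w_closure D ?A"] assms(1) w
    by (auto simp: w_ideal_def divisorial_ideal_def)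
  then show "divisorial_ideal (loc D P) J"
    using J J' L.fractional_ideal_sub by (auto simp: divisorial_ideal_def)
qed

lemma (in fraction_domain) w_divisorial_if_locally_divisorial:
  assumes "v_finite D" and loc: "\<And>M. M \<in> t_Max D \<Longrightarrow> divisorial_domain (loc D M)"
  shows "w_divisorial D"
  unfolding w_divisorial_def
proof (intro disjI2 allI impI)
  fix I assume w: "w_ideal D I"
  then have I: "fractional_ideal D I" "I \<noteq> {0}" "subK_module D I"
    by (auto simp: w_ideal_def fractional_ideal_def)
  obtain d where d: "d \<in> D" "d \<noteq> 0" "\<forall>x\<in>I. d * x \<in> D" using I by (auto simp: fractional_ideal_def)
  have "v_closure D I \<subseteq> w_closure D I"
    unfolding w_closure_eq[OF I(3)]
  proof (intro subsetI INT_I)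
    fix x M assume x: "x \<in> v_closure D I" and M: "M \<in> t_Max D"
    interpret M: prime_in_domain D M using in_prime_t_Max M by blast
    let ?L = "loc D M" and ?J = "localized D M I"
    have J: "subK_module ?L ?J" using M.module_localized I by blast
    \<comment> \<open>\<open>divisorial_domain\<close> speaks of integral ideals only, so
      \<open>?J\<close> is first multiplied into \<open>?L\<close>; the factor \<open>d\<close> is
      cancelled at the end.\<close>
    have dJ: "subK_module ?L ((*) d ` ?J)" using J by (rule M.L.module_scale)
    have "(*) d ` ?J \<subseteq> ?L"
      using localized_scale(1)[of _ D M I d D] d by (auto simp: M.loc_eq_localized)
    moreover obtain y where "y \<in> I" "y \<noteq> 0" using module_nonzero I by metis
    then have "d * y \<in> (*) d ` ?J" "d * y \<noteq> 0" using M.subset_localized[of I] d by auto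
    then have "(*) d ` ?J \<noteq> {0}" by blast
    ultimately have "divisorial_ideal ?L ((*) d ` ?J)"
      using loc[OF M] dJ M.L.ideal_ring_on_iff unfolding divisorial_domain_def by blast
    then have div: "v_closure ?L ((*) d ` ?J) = (*) d ` ?J"
      by (simp add: divisorial_ideal_def)
    have "x \<in> v_closure ?L ?J"
      using x M.localized_v_closure[OF assms(1) I(1,2)] M.subset_localized by blast
    then have "d * x \<in> v_closure ?L ((*) d ` ?J)"
      by (rule v_closure_scale)
    then show "x \<in> ?J" using div d by auto
  qed
  then have "I = v_closure D I" using w subset_v_closure[of I D] by (auto simp: w_ideal_def)
  then show "divisorial_ideal D I" using I by (simp add: divisorial_ideal_def)
qed

subsection \<open>Overrings\<close>

text \<open>Assumes the second alternative of \<open>t_flat\<close>; the final theorem settles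
  \<open>T = UNIV\<close> directly.\<close>

locale t_flat_overring = R: fraction_domain R + T: fraction_domain T
  for R T :: "'k::field set" +
  assumes sub: "R \<subseteq> T"
    and flat: "M \<in> t_Max T \<Longrightarrow> loc T M = loc R (M \<inter> R)"
begin

lemma contraction_prime:
  assumes "M \<in> t_Max T"
  shows "prime_of R (M \<inter> R)"
proof -
  interpret M: prime_in_domain T M using T.in_prime_t_Max assms by blast
  have "subK_module R (M \<inter> R)"
    using T.moduleD[OF M.prime_module] sub
    by (intro R.moduleI) (auto simp: R.zero_mem R.add_mem R.mult_mem)
  moreover have "1 \<notin> M \<inter> R" using M.one_notin_prime by blast
  then have "M \<inter> R \<subset> R" using R.one_mem by blast
  ultimately show ?thesis
    using M.prime sub unfolding prime_of_def by blast
qed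

lemma in_prime_contraction: "M \<in> t_Max T \<Longrightarrow> prime_in_domain R (M \<inter> R)"
  using contraction_prime R.fraction_domain_axioms
  by (simp add: prime_in_domain_def prime_in_domain_axioms_def)

lemma overring_denominator:
  assumes "M \<in> t_Max T" "x \<in> T"
  obtains s where "s \<in> R" "s \<notin> M" "s * x \<in> R"
proof -
  interpret M: prime_in_domain T M using T.in_prime_t_Max assms by blast
  interpret P: prime_in_domain R "M \<inter> R" using in_prime_contraction assms by blast
  have "x \<in> localized R (M \<inter> R) R"
    using assms flat[OF assms(1)] M.subset_localized[of T]
    by (auto simp: P.loc_eq_localized M.loc_eq_localized)
  then show ?thesis using that by (auto elim: localizedE)
qed

text \<open>The finite set found in \<open>R\<close> for the contraction of \<open>A\<close> works
  for \<open>A\<close> itself. At each t-maximal \<open>M\<close>, flatness gives denominators from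
  \<open>R\<close> outside \<open>M\<close>: one moves \<open>x\<close> into the inverse of the
  contraction, another moves \<open>a\<close> into the contraction.\<close>

lemma v_finite_overring:
  assumes R: "v_finite R"
  shows "v_finite T"
  unfolding v_finite_def
proof (intro allI impI)
  fix A assume A: "subK_module T A \<and> A \<subseteq> T"
  have "subK_module R (A \<inter> R)"
    using A T.moduleD[of A] sub
    by (intro R.moduleI) (auto simp: R.zero_mem R.add_mem R.mult_mem)
  then obtain F where F: "finite F" "F \<subseteq> A \<inter> R" "colon R F = colon R (A \<inter> R)"
    using R unfolding v_finite_def by (metis Int_lower2)
  have "x * a \<in> T" if x: "x \<in> colon T F" and a: "a \<in> A" for x a
  proof (rule T.Inter_loc_t_Max)
    fix M assume M: "M \<in> t_Max T"
    interpret M: prime_in_domain T M using T.in_prime_t_Max M by blast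
    interpret P: prime_in_domain R "M \<inter> R" using in_prime_contraction M by blast
    have "\<forall>f\<in>F. x * f \<in> localized R (M \<inter> R) R"
      using x M.subset_localized[of T] flat[OF M]
      by (auto simp: colon_def P.loc_eq_localized M.loc_eq_localized)
    then obtain s where s: "s \<in> R" "s \<notin> M" "\<forall>f\<in>F. s * x * f \<in> R"
      using P.common_denominator[OF F(1) _ R.module_self, of x] by blast
    then have "s * x \<in> colon R (A \<inter> R)" unfolding F(3)[symmetric] by (simp add: colon_def)
    moreover obtain u where u: "u \<in> R" "u \<notin> M" "u * a \<in> R"
      using overring_denominator M a A by blast
    moreover have "u * a \<in> A" using u a A sub T.moduleD(3)[of A u a] by blast
    ultimately have "s * x * (u * a) \<in> R" by (auto simp: colon_def)
    moreover have "s * u \<in> R" "s * u \<notin> M \<inter> R"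
      using s u R.mult_mem P.mult_notin_prime by auto
    ultimately have "x * a \<in> localized R (M \<inter> R) R"
      by (intro localizedI[of "s * u"]) (auto simp: ac_simps)
    then show "x * a \<in> loc T M" using flat[OF M] P.loc_eq_localized by simp
  qed
  then have "colon T F = colon T A" using colon_antimono[of F A T] F(2) by (auto simp: colon_def)
  then show "\<exists>F. finite F \<and> F \<subseteq> A \<and> colon T F = colon T A" using F by blast
qed

text \<open>Both $(M R_P)_v$ and $(F R_P)_v$ can be computed in $R_P = T_M$, for $P = M \cap R$.\<close>

lemma t_ideal_contraction:
  assumes R: "v_finite R" and M: "M \<in> t_Max T"
  shows "t_ideal R (M \<inter> R)"
  unfolding R.t_ideal_iff
proof (intro conjI allI impI)
  interpret M: prime_in_domain T M using T.in_prime_t_Max M by blast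
  interpret P: prime_in_domain R "M \<inter> R" using in_prime_contraction M by blast
  note tM = T.t_MaxD(1)[OF M]
  show "fractional_ideal R (M \<inter> R)" using P.prime_module P.prime_sub by (rule R.fractional_ideal_sub)
  obtain m where m: "m \<in> M" "m \<noteq> 0"
    using T.module_nonzero[OF T.t_idealD(1)[OF tM] T.t_idealD(3)[OF tM]] by blast
  obtain d where d: "d \<in> R" "d \<noteq> 0" "d * m \<in> R" using R.denominator by blast
  have "d * m \<in> M" using T.moduleD(3)[OF M.prime_module, of d m] m d sub by blast
  then show "M \<inter> R \<noteq> {0}" using d m by (metis Int_iff mult_eq_0_iff singletonD)
  fix F assume F: "finite F \<and> F \<subseteq> M \<inter> R"
  show "v_closure R F \<subseteq> M \<inter> R"
  proof
    fix x assume x: "x \<in> v_closure R F"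
    have xR: "x \<in> R" using x R.colon_sub(2)[of F] F by blast
    have "x \<in> colon (loc R (M \<inter> R)) (localized R (M \<inter> R) (colon R F))"
      using x P.subset_localized[of R] P.colon_loc_localized[of "colon R F"]
      by (auto simp: v_closure_def colon_def P.loc_eq_localized)
    then have "x \<in> v_closure (loc T M) F"
      using P.localized_colon_finite F flat[OF M] by (simp add: v_closure_def)
    moreover have "F \<subseteq> localized T M M" using F M.subset_localized by blast
    then have "v_closure (loc T M) F \<subseteq> v_closure (loc T M) (localized T M M)"
      by (rule v_closure_mono)
    \<comment> \<open>\<open>T\<close> is again \<open>v_finite\<close>, so the t-ideal
      \<open>M\<close> is divisorial, and this survives localization.\<close>
    moreover have "v_closure (loc T M) (localized T M M) = localized T M M"
      using M.localized_v_closure[OF v_finite_overring[OF R] T.t_idealD(2,3)[OF tM]]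
        T.v_closure_t_ideal[OF v_finite_overring[OF R] tM] by simp
    ultimately have "x \<in> localized T M M" by blast
    then obtain s where s: "s \<in> T" "s \<notin> M" "s * x \<in> M" by (rule localizedE)
    then show "x \<in> M \<inter> R" using xR sub M.prime by (auto simp: prime_of_def)
  qed
qed

text \<open>The contraction of \<open>M\<close> is a t-ideal, so it lies below a t-maximal ideal of
  \<open>R\<close>; thus the localization of \<open>T\<close> at \<open>M\<close> is a localization
  of \<open>R\<close> already known to be divisorial.\<close>

lemma w_divisorial_overring:
  assumes "v_finite R" "w_divisorial R" "R \<noteq> UNIV"
  shows "w_divisorial T"
proof (rule T.w_divisorial_if_locally_divisorial)
  show "v_finite T" using assms(1) by (rule v_finite_overring)
  fix M assume M: "M \<in> t_Max T"
  interpret P: prime_in_domain R "M \<inter> R" using in_prime_contraction M by blast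
  have "M \<inter> R \<subset> R" using P.prime by (simp add: prime_of_def)
  then obtain N where "N \<in> t_Max R" "M \<inter> R \<subseteq> N"
    using R.t_ideal_subset_t_Max[OF t_ideal_contraction[OF assms(1) M]] by blast
  then show "divisorial_domain (loc T M)"
    using P.divisorial_domain_loc assms flat[OF M] by metis
qed

end

section \<open>Generalized rings of fractions\<close>

locale ideal_system = fraction_domain R for R :: "'k::field set" +
  fixes F :: "'k set set"
  assumes system: "multiplicative_system R F"
begin

abbreviation "R_F \<equiv> generalized_fractions R F"

lemma mem_system:
  assumes "J \<in> F"
  shows "subK_module R J" "J \<subseteq> R"
  using assms system ideal_ring_on_iff by (auto simp: multiplicative_system_def)

lemma prod_mem_system: "I \<in> F \<Longrightarrow> J \<in> F \<Longrightarrow> ideal_prod (ring_on R) I J \<in> F"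
  using system by (auto simp: multiplicative_system_def)

lemma colon_ideal_prod:
  assumes "\<And>i j. i \<in> I \<Longrightarrow> j \<in> J \<Longrightarrow> x * (i * j) \<in> R"
  shows "x \<in> colon R (ideal_prod (ring_on R) I J)"
proof -
  have "x * y \<in> R" if "y \<in> ideal_prod (ring_on R) I J" for y
    using that by induction (use assms add_mem in \<open>auto simp: distrib_left\<close>)
  then show ?thesis by (simp add: colon_def)
qed

text \<open>A product with \<open>J\<close> lies inside \<open>I\<close>, so its inverse is larger.
  This brings elements of \<open>R_F\<close> with different ideals over one common ideal.\<close>

lemma colon_ideal_prod_left:
  assumes "x \<in> colon R I" "J \<in> F"
  shows "x \<in> colon R (ideal_prod (ring_on R) I J)" "x \<in> colon R (ideal_prod (ring_on R) J I)"
proof -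
  have *: "x * i * j \<in> R" if "i \<in> I" "j \<in> J" for i j
  proof (rule mult_mem)
    show "x * i \<in> R" using assms(1) that by (simp add: colon_def)
    show "j \<in> R" using mem_system(2)[OF assms(2)] that by blast
  qed
  show "x \<in> colon R (ideal_prod (ring_on R) I J)"
    by (rule colon_ideal_prod) (use * in \<open>simp add: mult.assoc\<close>)
  show "x \<in> colon R (ideal_prod (ring_on R) J I)"
    by (rule colon_ideal_prod) (use * in \<open>metis mult.assoc mult.commute\<close>)
qed

lemma subset_fractions: "R \<subseteq> R_F"
proof
  fix x assume x: "x \<in> R"
  obtain J where J: "J \<in> F" using system by (auto simp: multiplicative_system_def)
  then have "x \<in> colon R J" using x mem_system(2)[OF J] mult_mem by (auto simp: colon_def)
  then show "x \<in> R_F" using J by (auto simp: generalized_fractions_def)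
qed

lemma fractionsE:
  assumes "x \<in> R_F"
  obtains J where "J \<in> F" "x \<in> colon R J"
  using assms by (auto simp: generalized_fractions_def)

lemma fractionsI: "J \<in> F \<Longrightarrow> x \<in> colon R J \<Longrightarrow> x \<in> R_F"
  by (auto simp: generalized_fractions_def)

lemma overring_fractions: "overring R R_F"
  unfolding overring_def subring_ambient_iff
proof (intro conjI ballI)
  show "R \<subseteq> R_F" by (rule subset_fractions)
  then show "0 \<in> R_F" "1 \<in> R_F" using zero_mem one_mem by auto
  fix x assume "x \<in> R_F"
  then obtain I where I: "I \<in> F" "x \<in> colon R I" by (rule fractionsE)
  show "- x \<in> R_F" using I uminus_mem by (intro fractionsI[of I]) (auto simp: colon_def)
  fix y assume "y \<in> R_F"
  then obtain J where J: "J \<in> F" "y \<in> colon R J" by (rule fractionsE)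
  have IJ: "ideal_prod (ring_on R) I J \<in> F" using I J prod_mem_system by blast
  have "x + y \<in> colon R (ideal_prod (ring_on R) I J)"
    using colon_ideal_prod_left(1)[OF I(2) J(1)] colon_ideal_prod_left(2)[OF J(2) I(1)]
    by (rule moduleD(2)[OF module_colon])
  then show "x + y \<in> R_F" by (rule fractionsI[OF IJ])
  have "x * y \<in> colon R (ideal_prod (ring_on R) I J)"
  proof (rule colon_ideal_prod)
    fix i j assume "i \<in> I" "j \<in> J"
    then have "x * i \<in> R" "y * j \<in> R" using I J by (auto simp: colon_def)
    then have "(x * i) * (y * j) \<in> R" by (rule mult_mem)
    then show "x * y * (i * j) \<in> R" by (simp add: ac_simps)
  qed
  then show "x * y \<in> R_F" by (rule fractionsI[OF IJ])
qed

sublocale T: fraction_domain R_F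
  using fraction_domain_overring[OF fraction_domain_axioms overring_fractions] .

lemma common_system_ideal:
  assumes "finite G" "\<forall>g\<in>G. x * g \<in> R_F"
  shows "\<exists>J\<in>F. \<forall>g\<in>G. x * g \<in> colon R J"
  using assms
proof induction
  case empty
  then show ?case using system by (auto simp: multiplicative_system_def)
next
  case (insert h G)
  then obtain I where I: "I \<in> F" "\<forall>g\<in>G. x * g \<in> colon R I" by blast
  obtain J where J: "J \<in> F" "x * h \<in> colon R J" using insert fractionsE[of "x * h"] by blast
  show ?case
    using prod_mem_system[OF I(1) J(1)] colon_ideal_prod_left(1)[OF _ J(1)] I(2)
      colon_ideal_prod_left(2)[OF J(2) I(1)] by blast
qed

text \<open>If \<open>J\<close> in \<open>F\<close> were contained in \<open>M\<close>, a finite \<open>G\<close> with $(R:G) = (R:J)$ would satisfy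
  $(R_F:G) = R_F$, so that $1 \<in> G_v \<subseteq> M$.\<close>

lemma system_not_subset_t_Max:
  assumes "v_finite R" "J \<in> F" and M: "M \<in> t_Max R_F"
  shows "\<not> J \<subseteq> M"
proof
  assume JM: "J \<subseteq> M"
  interpret M: prime_in_domain R_F M using T.in_prime_t_Max M by blast
  obtain G where G: "finite G" "G \<subseteq> J" "colon R G = colon R J"
    using v_finite_fractional[OF assms(1) fractional_ideal_sub[OF mem_system[OF assms(2)]]] .
  have "x \<in> R_F" if "x \<in> colon R_F G" for x
  proof -
    have "\<forall>g\<in>G. x * g \<in> R_F" using that by (simp add: colon_def)
    then obtain I where I: "I \<in> F" "\<forall>g\<in>G. x * g \<in> colon R I"
      using common_system_ideal[OF G(1)] by blast
    have "x \<in> colon R (ideal_prod (ring_on R) I J)"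
    proof (rule colon_ideal_prod)
      fix i j assume i: "i \<in> I" and j: "j \<in> J"
      have "x * i \<in> colon R G" using I(2) i by (auto simp: colon_def ac_simps)
      then have "x * i * j \<in> R" using j unfolding G(3) by (simp add: colon_def)
      then show "x * (i * j) \<in> R" by (simp add: mult.assoc)
    qed
    then show ?thesis by (rule fractionsI[OF prod_mem_system[OF I(1) assms(2)]])
  qed
  then have "1 \<in> v_closure R_F G" unfolding v_closure_def colon_def[of R_F "colon _ _"] by simp
  moreover have "G \<subseteq> M" using G(2) JM by (rule subset_trans)
  then have "v_closure R_F G \<subseteq> M" using T.t_idealD(4)[OF T.t_MaxD(1)[OF M] G(1)] by simp
  ultimately show False using M.one_notin_prime by blast
qed

text \<open>An ideal of \<open>F\<close> that multiplies \<open>x\<close> into \<open>R\<close> is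
  not contained in \<open>M\<close>, so it supplies a denominator of \<open>x\<close> in
  \<open>R\<close> outside \<open>M\<close>.\<close>

lemma t_flat_fractions:
  assumes "v_finite R"
  shows "t_flat R R_F"
  unfolding t_flat_def
proof (intro disjI2 ballI)
  fix M assume M: "M \<in> t_Max R_F"
  interpret M: prime_in_domain R_F M using T.in_prime_t_Max M by blast
  have den: "\<exists>s\<in>R. s \<notin> M \<and> s * x \<in> R" if "x \<in> R_F" for x
  proof -
    obtain J where J: "J \<in> F" "x \<in> colon R J" using \<open>x \<in> R_F\<close> by (rule fractionsE)
    obtain s where s: "s \<in> J" "s \<notin> M" using system_not_subset_t_Max[OF assms J(1) M] by blast
    then have "x * s \<in> R" using J(2) by (simp add: colon_def)
    then show ?thesis using s mem_system(2)[OF J(1)] by (auto simp: mult.commute)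
  qed
  show "loc R_F M = loc R (M \<inter> R)"
  proof
    show "loc R (M \<inter> R) \<subseteq> loc R_F M" using subset_fractions by (auto simp: loc_def)
    show "loc R_F M \<subseteq> loc R (M \<inter> R)"
    proof
      fix x assume "x \<in> loc R_F M"
      then obtain a s where as: "a \<in> R_F" "s \<in> R_F" "s \<notin> M" "x = a / s" by (auto simp: loc_def)
      obtain u where u: "u \<in> R" "u \<notin> M" "u * a \<in> R" using den as(1) by blast
      obtain w where w: "w \<in> R" "w \<notin> M" "w * s \<in> R" using den as(2) by blast
      have RF: "u \<in> R_F" "w \<in> R_F" using u w subset_fractions by auto
      have "u * w \<notin> M" using M.mult_notin_prime RF u w by blast
      then have nz: "u * w \<noteq> 0" using M.zero_in_prime by metis
      have "w * s \<notin> M" using M.mult_notin_prime RF w as by blast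
      then have "u * (w * s) \<notin> M" using M.mult_notin_prime RF u w subset_fractions by blast
      moreover have "u * (w * s) \<in> R" "w * (u * a) \<in> R" using u w mult_mem by auto
      \<comment> \<open>Expanding \<open>a / s\<close> by \<open>u * w\<close> moves numerator and
        denominator into \<open>R\<close> at the same time.\<close>
      moreover have "x = w * (u * a) / (u * (w * s))" using as(4) nz by (simp add: field_simps)
      ultimately show "x \<in> loc R (M \<inter> R)" unfolding loc_def by blast
    qed
  qed
qed

end

section \<open>The equivalence of the five conditions\<close>

theorem theorem4p5:
  fixes R :: "'k::field set"
  assumes "domain_with_qf R" and "R \<noteq> UNIV" and "Mori R"
  shows "(w_divisorial R \<longleftrightarrow> strongly_w_divisorial R)
       \<and> (w_divisorial R \<longleftrightarrow> (\<forall>T. overring R T \<and> t_flat R T \<longrightarrow> w_divisorial T))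
       \<and> (w_divisorial R \<longleftrightarrow>
            (\<forall>F. multiplicative_system R F \<longrightarrow> w_divisorial (generalized_fractions R F)))
       \<and> (w_divisorial R \<longleftrightarrow> (\<forall>M\<in>t_Max R. divisorial_domain (loc R M)))"
proof -
  interpret R: fraction_domain R using assms(1) by (rule domain_with_qf_fraction_domain)
  have vf: "v_finite R" using assms(3) by (rule R.Mori_v_finite)
  have loc: "divisorial_domain (loc R P)"
    if "w_divisorial R" "prime_of R P" "M \<in> t_Max R" "P \<subseteq> M" for P M
  proof -
    interpret prime_in_domain R P by unfold_locales (rule that(2))
    show ?thesis using divisorial_domain_loc vf that assms(2) by blast
  qed
  have strong: "strongly_w_divisorial R" if w: "w_divisorial R"
    unfolding strongly_w_divisorial_def
  proof (intro conjI ballI w)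
    fix P assume "P \<in> t_Spec R"
    then have P: "prime_of R P" "t_ideal R P"
      using R.primeideal_prime_of by (auto simp: t_Spec_def)
    then obtain M where "M \<in> t_Max R" "P \<subseteq> M"
      using R.t_ideal_subset_t_Max unfolding prime_of_def by blast
    then show "divisorial_domain (loc R P)" using loc w P by blast
  qed
  have flat: "w_divisorial T" if w: "w_divisorial R" and T: "overring R T" "t_flat R T" for T
  proof (cases "T = UNIV")
    case False
    interpret T: fraction_domain T
      using fraction_domain_overring[OF R.fraction_domain_axioms T(1)] .
    interpret t_flat_overring R T
      using T False by unfold_locales (auto simp: overring_def t_flat_def)
    show ?thesis using w_divisorial_overring vf w assms(2) by blast
  qed (simp add: w_divisorial_def)
  have fractions: "w_divisorial (generalized_fractions R F)"
    if w: "w_divisorial R" and F: "multiplicative_system R F" for F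
  proof -
    interpret ideal_system R F by unfold_locales (rule F)
    show ?thesis using flat[OF w overring_fractions t_flat_fractions[OF vf]] .
  qed
  \<comment> \<open>The converse from condition (3): \<open>R\<close> is a t-flat overring of
    itself.\<close>
  have "overring R R" using R.subring_ambient by (simp add: overring_def)
  moreover have "t_flat R R"
    using R.t_MaxD(2) unfolding t_flat_def by (metis Int_absorb2 psubset_imp_subset)
  ultimately have flat': "w_divisorial R" if "\<forall>T. overring R T \<and> t_flat R T \<longrightarrow> w_divisorial T"
    using that by blast
  \<comment> \<open>The converse from condition (4): the multiplicative system \<open>{R}\<close>
    has \<open>R\<close> as its ring of fractions.\<close>
  have R: "ideal R (ring_on R)" using R.module_self by (simp add: R.ideal_ring_on_iff)
  interpret ring "ring_on R"
    using ring.subring_is_ring[OF ring_from_type_algebra R.subring_ambient] by simp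
  have "x \<in> ideal_prod (ring_on R) R R" if "x \<in> R" for x
    using ideal_prod.prod[OF that R.one_mem, of "ring_on R"] by simp
  then have RR: "ideal_prod (ring_on R) R R = R" using ideal_prod_inter[OF R R] by blast
  have "R \<noteq> {0}" using R.one_mem by force
  then have "multiplicative_system R {R}" using R RR by (simp add: multiplicative_system_def)
  moreover have "generalized_fractions R {R} = R"
    using R.one_mem R.mult_mem by (force simp: generalized_fractions_def colon_def)
  ultimately have fractions': "w_divisorial R"
    if "\<forall>F. multiplicative_system R F \<longrightarrow> w_divisorial (generalized_fractions R F)"
    using that by metis
  have "w_divisorial R" if "strongly_w_divisorial R"
    using that by (simp add: strongly_w_divisorial_def)
  moreover have "divisorial_domain (loc R M)" if "w_divisorial R" "M \<in> t_Max R" for M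
    using loc[OF that(1) R.t_Max_prime[OF that(2)] that(2)] by blast
  moreover have "w_divisorial R" if "\<forall>M\<in>t_Max R. divisorial_domain (loc R M)"
    using R.w_divisorial_if_locally_divisorial vf that by blast
  ultimately show ?thesis using strong flat flat' fractions fractions' by blast
qed

end
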